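(* Let $G$ and $H$ be two graphs with Hermitian adjacency matrices $A_G$ and $A_H$, and let $S\subset V(G)$ and $T\subset V(H)$ be such that, under an identification (bijection) of $S$ with $T$, $\mathcal{R}(\lambda,S,A_G)=\mathcal{R}(\lambda,T,A_H)$. Then there is perfect state transfer between two vertices of $S$ in $G$ if and only if there is perfect state transfer between the two corresponding vertices of $T$ in $H$.
   Context: For $A=\begin{bmatrix} M & C \\ D & F \end{bmatrix}$ with the $M$ block indexed by $S$, the isospectral reduction is $\mathcal{R}(\lambda,S,A)=M+C(\lambda I-F)^{-1}D$, a matrix of rational functions in $\lambda$. The quantum walk on a graph with adjacency matrix $A$ is given by the transition matrix $U(t)=e^{-itA}$, which is unitary. There is perfect state transfer from vertex $u$ to vertex $v$ at time $\tau$ if $U(\tau)e_u=\gamma e_v$ for some complex number $\gamma$ with $|\gamma|=1$, where $e_x$ is the indicator vector of vertex $x$; there is perfect state transfer from $u$ to $v$ if this happens at some time $\tau$. *)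

theory Defs
  imports "HOL-Analysis.Analysis" "HOL-Computational_Algebra.Computational_Algebra"
begin

text \<open>
  A graph on a finite vertex type is given by its adjacency matrix, with arbitrary complex edge
  weights and loops allowed.
\<close>

definition hermitian :: "complex^'n^'n \<Rightarrow> bool" where
  "hermitian A \<longleftrightarrow> (\<forall>i j. A $ i $ j = cnj (A $ j $ i))"

type_synonym ratfun = "complex poly fract"

definition ratfun_const :: "complex \<Rightarrow> ratfun" where
  "ratfun_const c = to_fract [:c:]"

definition ratfun_var :: ratfun where
  "ratfun_var = to_fract [:0, 1:]"

text \<open>
  \<open>is_inverse_on W X Y\<close>: the block of \<open>Y\<close> with rows and columns in \<open>W\<close> is the two-sided inverse
  of the corresponding block of \<open>X\<close>. Entries outside the block are irrelevant, so
  \<open>inverse_on W X\<close> is determined only on \<open>W\<close>. The set \<open>W\<close> may be empty.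
\<close>

definition is_inverse_on :: "'n set \<Rightarrow> 'a::field^'n^'n \<Rightarrow> 'a^'n^'n \<Rightarrow> bool" where
  "is_inverse_on W X Y \<longleftrightarrow>
     (\<forall>i\<in>W. \<forall>j\<in>W.
        (\<Sum>k\<in>W. X $ i $ k * Y $ k $ j) = (if i = j then 1 else 0) \<and>
        (\<Sum>k\<in>W. Y $ i $ k * X $ k $ j) = (if i = j then 1 else 0))"

definition inverse_on :: "'n set \<Rightarrow> 'a::field^'n^'n \<Rightarrow> 'a^'n^'n" where
  "inverse_on W X = (SOME Y. is_inverse_on W X Y)"

definition char_matrix :: "complex^'n^'n \<Rightarrow> ratfun^'n^'n" where
  "char_matrix A =
     (\<chi> i j. (if i = j then ratfun_var else 0) - ratfun_const (A $ i $ j))"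

text \<open>
  The entry at \<open>(u, v)\<close> of \<open>M + C (\<lambda>I - F)\<^sup>-\<^sup>1 D\<close>, where \<open>M\<close>, \<open>C\<close>, \<open>D\<close>, \<open>F\<close> are the blocks of
  \<open>A\<close> indexed by \<open>S \<times> S\<close>, \<open>S \<times> -S\<close>, \<open>-S \<times> S\<close> and \<open>-S \<times> -S\<close>, and \<open>\<lambda>\<close> is the indeterminate
  \<open>ratfun_var\<close>. Since \<open>\<lambda>I - F\<close> is the \<open>-S\<close> block of \<open>char_matrix A\<close> and its determinant is a monic
  polynomial, the inverse exists. Only the entries with \<open>u, v \<in> S\<close> are meaningful.
\<close>

definition isospectral_reduction ::
  "('n::finite) set \<Rightarrow> complex^'n^'n \<Rightarrow> 'n \<Rightarrow> 'n \<Rightarrow> ratfun" where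
  "isospectral_reduction S A u v =
     ratfun_const (A $ u $ v) +
     (\<Sum>i\<in>-S. \<Sum>j\<in>-S.
        ratfun_const (A $ u $ i) * inverse_on (-S) (char_matrix A) $ i $ j
          * ratfun_const (A $ j $ v))"

primrec matrix_pow :: "'a::semiring_1^'n^'n \<Rightarrow> nat \<Rightarrow> 'a^'n^'n" where
  "matrix_pow A 0 = mat 1"
| "matrix_pow A (Suc k) = A ** matrix_pow A k"

definition matrix_exp :: "complex^'n^'n \<Rightarrow> complex^'n^'n" where
  "matrix_exp A = (\<Sum>k. (1 / fact k) *\<^sub>R matrix_pow A k)"

definition transition_matrix :: "complex^'n^'n \<Rightarrow> real \<Rightarrow> complex^'n^'n" where
  "transition_matrix A t = matrix_exp (\<chi> i j. - (\<i> * of_real t) * A $ i $ j)"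

definition pst_at :: "complex^'n^'n \<Rightarrow> real \<Rightarrow> 'n \<Rightarrow> 'n \<Rightarrow> bool" where
  "pst_at A \<tau> u v \<longleftrightarrow>
     (\<exists>\<gamma>::complex. norm \<gamma> = 1 \<and> transition_matrix A \<tau> *v axis u 1 = \<gamma> *s axis v 1)"

definition perfect_state_transfer :: "complex^'n^'n \<Rightarrow> 'n \<Rightarrow> 'n \<Rightarrow> bool" where
  "perfect_state_transfer A u v \<longleftrightarrow> (\<exists>\<tau>. pst_at A \<tau> u v)"

end

theory Submission
  imports Defs
begin

text \<open>
  Expanding \<open>(\<lambda>I - F)\<^sup>-\<^sup>1\<close> at infinity, the reduction is the generating function of the numbers
  \<open>M, C D, C F D, C F\<^sup>2 D, \<dots>\<close>, the total weights of the walks between vertices of \<open>S\<close> that avoid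
  \<open>S\<close> in between. Decomposing an arbitrary walk at its visits to \<open>S\<close>, these numbers determine the
  block of every power \<open>A\<^sup>k\<close> on \<open>S\<close>, hence that block of \<open>U(t)\<close>. As \<open>U(t)\<close> is unitary, there is
  perfect state transfer from \<open>u\<close> to \<open>v\<close> at time \<open>t\<close> iff the single entry \<open>U(t)\<^sub>v\<^sub>u\<close> has modulus 1.
\<close>

section \<open>Rational functions vanishing at infinity\<close>

lemma ratfun_const_0 [simp]: "ratfun_const 0 = 0"
  by (simp add: ratfun_const_def)

lemma ratfun_const_add: "ratfun_const (a + b) = ratfun_const a + ratfun_const b"
  by (simp add: ratfun_const_def flip: to_fract_add)

lemma ratfun_const_mult: "ratfun_const (a * b) = ratfun_const a * ratfun_const b"
  by (simp add: ratfun_const_def flip: to_fract_mult)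

lemma ratfun_const_sum: "ratfun_const (sum f I) = (\<Sum>i\<in>I. ratfun_const (f i))"
  by (induction I rule: infinite_finite_induct) (simp_all add: ratfun_const_add)

text \<open>Vanishing at infinity, stated by cross-multiplication so that fractions need no normal
  form. The strict degree bound already forces \<open>q\<close> to be nonzero.\<close>

definition strictly_proper :: "ratfun \<Rightarrow> bool" where
  "strictly_proper f \<longleftrightarrow> (\<exists>p q. f * to_fract q = to_fract p \<and> degree p < degree q)"

lemma strictly_proper_0 [simp]: "strictly_proper 0"
  unfolding strictly_proper_def
  \<comment> \<open>As \<open>degree 0\<close> is 0, even the zero fraction needs a denominator of
    positive degree.\<close>
  by (intro exI[of _ 0] exI[of _ "[:0, 1:]"]) simp

lemma strictly_proper_add:
  assumes "strictly_proper f" "strictly_proper g"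
  shows "strictly_proper (f + g)"
proof -
  obtain p q where f: "f * to_fract q = to_fract p" "degree p < degree q"
    using assms(1) by (auto simp: strictly_proper_def)
  obtain p' q' where g: "g * to_fract q' = to_fract p'" "degree p' < degree q'"
    using assms(2) by (auto simp: strictly_proper_def)
  have nz: "q \<noteq> 0" "q' \<noteq> 0"
    using f(2) g(2) by auto
  have "(f + g) * to_fract (q * q') = (f * to_fract q) * to_fract q' + (g * to_fract q') * to_fract q"
    by (simp add: to_fract_mult algebra_simps)
  also have "\<dots> = to_fract (p * q' + p' * q)"
    by (simp add: f g to_fract_mult to_fract_add)
  finally have eq: "(f + g) * to_fract (q * q') = to_fract (p * q' + p' * q)" .
  have "degree (p * q') < degree (q * q')" "degree (p' * q) < degree (q * q')"
    using degree_mult_le[of p q'] degree_mult_le[of p' q] f(2) g(2) nz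
    by (auto simp: degree_mult_eq)
  then have "degree (p * q' + p' * q) < degree (q * q')"
    by (rule degree_add_less)
  then show ?thesis
    using eq unfolding strictly_proper_def by blast
qed

lemma strictly_proper_const_mult:
  assumes "strictly_proper f"
  shows "strictly_proper (ratfun_const c * f)"
proof -
  obtain p q where f: "f * to_fract q = to_fract p" "degree p < degree q"
    using assms by (auto simp: strictly_proper_def)
  have "ratfun_const c * f * to_fract q = to_fract (smult c p)"
    using f(1) by (simp add: ratfun_const_def mult.assoc flip: to_fract_mult)
  moreover have "degree (smult c p) < degree q"
    using degree_smult_le[of c p] f(2) by linarith
  ultimately show ?thesis
    unfolding strictly_proper_def by blast
qed

lemma strictly_proper_sum:
  "(\<And>i. i \<in> I \<Longrightarrow> strictly_proper (f i)) \<Longrightarrow> strictly_proper (sum f I)"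
  by (induction I rule: infinite_finite_induct) (simp_all add: strictly_proper_add)

lemma strictly_proper_const_iff [simp]: "strictly_proper (ratfun_const c) \<longleftrightarrow> c = 0"
proof
  assume "strictly_proper (ratfun_const c)"
  then obtain p q where "ratfun_const c * to_fract q = to_fract p" and d: "degree p < degree q"
    by (auto simp: strictly_proper_def)
  then have "p = smult c q"
    by (simp add: ratfun_const_def flip: to_fract_mult)
  with d show "c = 0"
    by (metis degree_smult_eq less_irrefl)
qed simp

text \<open>The value at infinity is unique: the difference of the constants is itself strictly
  proper, hence 0. This reads off the coefficients of an expansion at infinity one at a
  time.\<close>

lemma const_plus_strictly_proper_eqD:
  assumes "ratfun_const a + f = ratfun_const b + g" "strictly_proper f" "strictly_proper g"
  shows "a = b \<and> f = g"
proof -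
  have "ratfun_const 1 = 1"
    by (simp add: ratfun_const_def flip: one_pCons)
  then have "ratfun_const (-1) = -1"
    using ratfun_const_add[of "-1" 1] by (simp add: eq_neg_iff_add_eq_0)
  then have "ratfun_const (b - a) = f + ratfun_const (-1) * g"
    using assms(1) ratfun_const_add[of "b - a" a] by (simp add: algebra_simps)
  moreover have "strictly_proper \<dots>"
    by (intro strictly_proper_add strictly_proper_const_mult assms)
  ultimately have "a = b"
    by (metis strictly_proper_const_iff eq_iff_diff_eq_0)
  then show ?thesis
    using assms(1) by simp
qed

text \<open>Turns a finite system of equations over rational functions into one over polynomials,
  where degrees can be compared.\<close>

lemma common_denominator:
  fixes x :: "'i \<Rightarrow> ratfun"
  assumes "finite I"
  obtains q p where "q \<noteq> 0" "\<And>i. i \<in> I \<Longrightarrow> x i * to_fract q = to_fract (p i)"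
proof -
  have "\<exists>q p. q \<noteq> 0 \<and> (\<forall>i\<in>I. x i * to_fract q = to_fract (p i))"
    using assms
  proof (induction I rule: finite_induct)
    case empty
    show ?case by (intro exI[of _ 1]) auto
  next
    case (insert a I)
    then obtain q p where qp: "q \<noteq> 0" "\<forall>i\<in>I. x i * to_fract q = to_fract (p i)"
      by blast
    obtain r s where rs: "x a = Fract r s" "s \<noteq> 0"
      by (cases "x a") auto
    have a: "x a * to_fract s = to_fract r"
      using rs by (simp add: to_fract_def eq_fract)
    have "x i * to_fract (q * s) = to_fract (if i = a then r * q else p i * s)"
      if "i \<in> insert a I" for i
    proof (cases "i = a")
      case True
      have "x a * to_fract (q * s) = x a * to_fract s * to_fract q"
        by (simp add: to_fract_mult)
      with True a show ?thesis by (simp add: to_fract_mult)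
    next
      case False
      have "x i * to_fract (q * s) = x i * to_fract q * to_fract s"
        by (simp add: to_fract_mult)
      with False that qp show ?thesis by (simp add: to_fract_mult)
    qed
    then show ?case
      using qp(1) rs(2) by (intro exI[of _ "q * s"] exI[of _ "\<lambda>i. if i = a then r * q else p i * s"]) auto
  qed
  then show ?thesis using that by blast
qed

section \<open>The resolvent of a principal block\<close>

text \<open>
  A numerator of maximal degree cannot have degree at least that of \<open>q\<close>, since multiplication by
  the indeterminate raises its degree beyond everything on the right-hand side.
\<close>

lemma resolvent_numerator_degree:
  fixes x :: "'i \<Rightarrow> ratfun"
  assumes "finite W"
    and num: "\<And>i. i \<in> W \<Longrightarrow> x i * to_fract q = to_fract (p i)"
    and eq: "\<And>i. i \<in> W \<Longrightarrow>
      ratfun_var * x i = ratfun_const (b i) + (\<Sum>k\<in>W. ratfun_const (F i k) * x k)"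
    and "i \<in> W"
  shows "p i = 0 \<or> degree (p i) < degree q"
proof (rule ccontr)
  assume bad: "\<not> ?thesis"
  \<comment> \<open>Zero numerators are left out because \<open>pCons 0\<close> raises the degree of
    nonzero polynomials only.\<close>
  let ?B = "{k \<in> W. p k \<noteq> 0}"
  have "finite ?B" "?B \<noteq> {}"
    using assms(1,4) bad by auto
  then have "Max ((\<lambda>k. degree (p k)) ` ?B) \<in> (\<lambda>k. degree (p k)) ` ?B"
    by (intro Max_in) auto
  then obtain j where "j \<in> ?B" "degree (p j) = Max ((\<lambda>k. degree (p k)) ` ?B)"
    by force
  then have j: "j \<in> ?B" "\<And>k. k \<in> ?B \<Longrightarrow> degree (p k) \<le> degree (p j)"
    using \<open>finite ?B\<close> by auto
  have le: "degree (p k) \<le> degree (p j)" if "k \<in> W" for k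
    using j(2)[of k] that by (cases "p k = 0") auto
  have "to_fract (pCons 0 (p j)) = ratfun_var * x j * to_fract q"
    using j(1) num[of j] by (simp add: ratfun_var_def mult.assoc flip: to_fract_mult)
  also have "\<dots> = ratfun_const (b j) * to_fract q
      + (\<Sum>k\<in>W. ratfun_const (F j k) * (x k * to_fract q))"
    using j(1) by (simp add: eq distrib_right sum_distrib_right mult.assoc)
  also have "(\<Sum>k\<in>W. ratfun_const (F j k) * (x k * to_fract q))
      = (\<Sum>k\<in>W. to_fract (smult (F j k) (p k)))"
    by (intro sum.cong) (simp_all add: num ratfun_const_def flip: to_fract_mult)
  also have "\<dots> = to_fract (\<Sum>k\<in>W. smult (F j k) (p k))"
    using assms(1) by (induction W rule: finite_induct) simp_all
  also have "ratfun_const (b j) * to_fract q + \<dots>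
      = to_fract (smult (b j) q + (\<Sum>k\<in>W. smult (F j k) (p k)))"
    by (simp add: ratfun_const_def to_fract_add flip: to_fract_mult)
  finally have "pCons 0 (p j) = smult (b j) q + (\<Sum>k\<in>W. smult (F j k) (p k))"
    by (simp only: to_fract_eq_iff)
  \<comment> \<open>The negated goal gives \<open>degree q \<le> degree (p i)\<close>, and
    \<open>degree (p j)\<close> is maximal.\<close>
  moreover have "degree (smult (b j) q) \<le> degree (p j)"
    using bad le[OF assms(4)] degree_smult_le[of "b j" q] by linarith
  moreover have "degree (\<Sum>k\<in>W. smult (F j k) (p k)) \<le> degree (p j)"
    by (intro degree_sum_le assms(1)) (use le degree_smult_le order.trans in blast)
  ultimately have "degree (pCons 0 (p j)) \<le> degree (p j)"
    by (metis degree_add_le)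
  then show False
    using j(1) by simp
qed

text \<open>Every solution of (\<lambda>I - F) x = b with constant F and b vanishes at infinity. A
  zero numerator is treated apart, since \<open>q\<close> may then be constant.\<close>

lemma strictly_proper_resolvent:
  fixes x :: "'i \<Rightarrow> ratfun"
  assumes "finite W"
    and "\<And>i. i \<in> W \<Longrightarrow>
      ratfun_var * x i = ratfun_const (b i) + (\<Sum>k\<in>W. ratfun_const (F i k) * x k)"
    and "i \<in> W"
  shows "strictly_proper (x i)"
proof -
  obtain q p where qp: "q \<noteq> 0" "\<And>i. i \<in> W \<Longrightarrow> x i * to_fract q = to_fract (p i)"
    using common_denominator[OF assms(1), of x] by blast
  have "p i = 0 \<or> degree (p i) < degree q"
    by (rule resolvent_numerator_degree[OF assms(1) qp(2) assms(2,3)])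
  then show ?thesis
  proof
    assume "p i = 0"
    then have "x i = 0"
      using qp(1) qp(2)[OF assms(3)] by simp
    then show ?thesis by simp
  next
    assume "degree (p i) < degree q"
    then show ?thesis
      using qp(2)[OF assms(3)] unfolding strictly_proper_def by blast
  qed
qed

text \<open>This is the trivial kernel of \<lambda>I - F, obtained without determinants: clearing
  denominators gives a polynomial solution, and the degree bound with denominator 1 leaves only
  zero.\<close>

lemma resolvent_unique:
  fixes x :: "'i \<Rightarrow> ratfun"
  assumes "finite W"
    and eq: "\<And>i. i \<in> W \<Longrightarrow> ratfun_var * x i = (\<Sum>k\<in>W. ratfun_const (F i k) * x k)"
    and "i \<in> W"
  shows "x i = 0"
proof -
  obtain q p where qp: "q \<noteq> 0" "\<And>i. i \<in> W \<Longrightarrow> x i * to_fract q = to_fract (p i)"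
    using common_denominator[OF assms(1), of x] by blast
  let ?y = "\<lambda>i. x i * to_fract q"
  have "p i = 0 \<or> degree (p i) < degree (1 :: complex poly)"
  proof (rule resolvent_numerator_degree[where x = ?y and b = "\<lambda>_. 0", OF assms(1) _ _ assms(3)])
    fix j assume "j \<in> W"
    then have "ratfun_var * (x j * to_fract q)
        = (\<Sum>k\<in>W. ratfun_const (F j k) * x k) * to_fract q"
      using eq[of j] by (metis mult.assoc)
    then show "ratfun_var * ?y j = ratfun_const 0 + (\<Sum>k\<in>W. ratfun_const (F j k) * ?y k)"
      by (simp add: sum_distrib_right mult.assoc)
  qed (simp add: qp)
  then have "p i = 0"
    by simp
  then show ?thesis
    using qp(1) qp(2)[OF assms(3)] by simp
qed

text \<open>Justifies the choice made in \<open>inverse_on\<close>. A square matrix over a field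
  with trivial kernel has a left inverse, which is also a right inverse.\<close>

lemma is_inverse_on_inverse_on:
  fixes A :: "complex^'n^'n"
  shows "is_inverse_on W (char_matrix A) (inverse_on W (char_matrix A))"
proof -
  text \<open>Cutting \<open>A\<close> down to \<open>W\<close> makes \<open>\<lambda>I - A\<close> block diagonal, so that inverting the whole
    matrix inverts the block.\<close>
  define F :: "complex^'n^'n" where "F = (\<chi> i j. if i \<in> W \<and> j \<in> W then A $ i $ j else 0)"
  have "x = 0" if "char_matrix F *v x = 0" for x :: "ratfun^'n"
  proof -
    have eq: "ratfun_var * x $ i = (\<Sum>k\<in>UNIV. ratfun_const (F $ i $ k) * x $ k)" for i
    proof -
      have "0 = (char_matrix F *v x) $ i"
        by (simp add: that)
      also have "\<dots> = (\<Sum>k\<in>UNIV. (if i = k then ratfun_var * x $ k else 0)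
          - ratfun_const (F $ i $ k) * x $ k)"
        unfolding matrix_vector_mult_def vec_lambda_beta
        by (intro sum.cong refl) (simp add: char_matrix_def left_diff_distrib)
      also have "\<dots> = ratfun_var * x $ i - (\<Sum>k\<in>UNIV. ratfun_const (F $ i $ k) * x $ k)"
        by (simp add: sum_subtractf)
      finally show ?thesis
        by (rule eq_iff_diff_eq_0[THEN iffD2, OF sym])
    qed
    have "x $ i = 0" for i
      by (rule resolvent_unique[where x = "\<lambda>i. x $ i" and F = "\<lambda>i k. F $ i $ k", OF _ eq UNIV_I]) simp
    then show "x = 0"
      by (simp add: vec_eq_iff)
  qed
  then have "\<exists>Y. Y ** char_matrix F = mat 1"
    unfolding matrix_left_invertible_ker by blast
  then obtain Y where Y: "Y ** char_matrix F = mat 1" ..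
  then have Y': "char_matrix F ** Y = mat 1"
    by (rule matrix_left_right_inverse[THEN iffD1])
  \<comment> \<open>\<open>char_matrix F\<close> has no nonzero entry linking \<open>W\<close> to
    its complement, so products within \<open>W\<close> may be summed over all indices.\<close>
  have restrict: "(\<Sum>k\<in>W. f k) = sum f UNIV" if "\<And>k. k \<notin> W \<Longrightarrow> f k = 0" for f :: "'n \<Rightarrow> ratfun"
    by (intro sum.mono_neutral_left) (use that in auto)
  have "is_inverse_on W (char_matrix A) Y"
    unfolding is_inverse_on_def
  proof (intro ballI conjI)
    fix i j assume ij: "i \<in> W" "j \<in> W"
    have "(\<Sum>k\<in>W. char_matrix A $ i $ k * Y $ k $ j) = (\<Sum>k\<in>W. char_matrix F $ i $ k * Y $ k $ j)"
      using ij by (intro sum.cong) (auto simp: char_matrix_def F_def)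
    also have "\<dots> = (char_matrix F ** Y) $ i $ j"
      unfolding matrix_matrix_mult_def
      using ij by (subst restrict) (auto simp: char_matrix_def F_def)
    finally show "(\<Sum>k\<in>W. char_matrix A $ i $ k * Y $ k $ j) = (if i = j then 1 else 0)"
      by (simp add: Y' mat_def)
    have "(\<Sum>k\<in>W. Y $ i $ k * char_matrix A $ k $ j) = (\<Sum>k\<in>W. Y $ i $ k * char_matrix F $ k $ j)"
      using ij by (intro sum.cong) (auto simp: char_matrix_def F_def)
    also have "\<dots> = (Y ** char_matrix F) $ i $ j"
      unfolding matrix_matrix_mult_def
      using ij by (subst restrict) (auto simp: char_matrix_def F_def)
    finally show "(\<Sum>k\<in>W. Y $ i $ k * char_matrix A $ k $ j) = (if i = j then 1 else 0)"
      by (simp add: Y mat_def)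
  qed
  then show ?thesis
    unfolding inverse_on_def by (rule someI)
qed

section \<open>Walks avoiding a set\<close>

text \<open>\<open>avoiding_walks S A j i v\<close> is the total weight of the walks of length \<open>j + 1\<close> from \<open>i\<close> to
  \<open>v\<close> whose interior vertices lie outside \<open>S\<close>.\<close>

primrec avoiding_walks :: "'n::finite set \<Rightarrow> complex^'n^'n \<Rightarrow> nat \<Rightarrow> 'n \<Rightarrow> 'n \<Rightarrow> complex" where
  "avoiding_walks S A 0 i v = A $ i $ v"
| "avoiding_walks S A (Suc j) i v = (\<Sum>k\<in>-S. A $ i $ k * avoiding_walks S A j k v)"

text \<open>\<open>reduction_tail S A j u v\<close> is the remainder after \<open>j\<close> terms in the expansion of the
  reduction at infinity, multiplied by \<open>\<lambda>\<^sup>j\<close>.\<close>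

primrec reduction_tail :: "'n::finite set \<Rightarrow> complex^'n^'n \<Rightarrow> nat \<Rightarrow> 'n \<Rightarrow> 'n \<Rightarrow> ratfun" where
  "reduction_tail S A 0 i v =
     (\<Sum>j\<in>-S. inverse_on (-S) (char_matrix A) $ i $ j * ratfun_const (A $ j $ v))"
| "reduction_tail S A (Suc j) i v = (\<Sum>k\<in>-S. ratfun_const (A $ i $ k) * reduction_tail S A j k v)"

section \<open>Expansion of the reduction at infinity\<close>

lemma isospectral_reduction_eq_tail:
  "isospectral_reduction S A u v
     = ratfun_const (avoiding_walks S A 0 u v) + reduction_tail S A (Suc 0) u v"
  by (simp add: isospectral_reduction_def sum_distrib_left mult.assoc)

text \<open>With x = (\<lambda>I - F)^(-1) D this is \<lambda>x = D + Fx, from the rows of the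
  inverse identity. That identity is available only for rows outside \<open>S\<close>.\<close>

lemma var_mult_reduction_tail_0:
  assumes "i \<in> -S"
  shows "ratfun_var * reduction_tail S A 0 i v
    = ratfun_const (A $ i $ v) + (\<Sum>k\<in>-S. ratfun_const (A $ i $ k) * reduction_tail S A 0 k v)"
proof -
  define X where "X = inverse_on (-S) (char_matrix A)"
  have col: "ratfun_var * X $ i $ j
      = (if i = j then 1 else 0) + (\<Sum>k\<in>-S. ratfun_const (A $ i $ k) * X $ k $ j)"
    if "j \<in> -S" for j
  proof -
    have "(if i = j then 1 else 0) = (\<Sum>k\<in>-S. char_matrix A $ i $ k * X $ k $ j)"
      using is_inverse_on_inverse_on[of "-S" A] assms that
      unfolding is_inverse_on_def X_def by simp
    also have "\<dots> = (\<Sum>k\<in>-S. (if i = k then ratfun_var * X $ k $ j else 0)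
        - ratfun_const (A $ i $ k) * X $ k $ j)"
      by (intro sum.cong) (auto simp: char_matrix_def algebra_simps)
    also have "\<dots> = ratfun_var * X $ i $ j - (\<Sum>k\<in>-S. ratfun_const (A $ i $ k) * X $ k $ j)"
      using assms by (simp add: sum_subtractf)
    finally show ?thesis
      by (simp add: algebra_simps)
  qed
  have "ratfun_var * reduction_tail S A 0 i v
      = (\<Sum>j\<in>-S. (ratfun_var * X $ i $ j) * ratfun_const (A $ j $ v))"
    by (simp add: X_def sum_distrib_left mult.assoc)
  also have "\<dots> = (\<Sum>j\<in>-S. (if i = j then ratfun_const (A $ j $ v) else 0)
      + (\<Sum>k\<in>-S. ratfun_const (A $ i $ k) * (X $ k $ j * ratfun_const (A $ j $ v))))"
    by (intro sum.cong) (auto simp: col distrib_right sum_distrib_right mult.assoc)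
  also have "\<dots> = ratfun_const (A $ i $ v)
      + (\<Sum>j\<in>-S. \<Sum>k\<in>-S. ratfun_const (A $ i $ k) * (X $ k $ j * ratfun_const (A $ j $ v)))"
    using assms by (simp add: sum.distrib)
  also have "(\<Sum>j\<in>-S. \<Sum>k\<in>-S. ratfun_const (A $ i $ k) * (X $ k $ j * ratfun_const (A $ j $ v)))
      = (\<Sum>k\<in>-S. ratfun_const (A $ i $ k) * reduction_tail S A 0 k v)"
    by (subst sum.swap) (simp add: X_def sum_distrib_left)
  finally show ?thesis .
qed

text \<open>On rows in \<open>S\<close>, the tail of index \<open>Suc j\<close> is C F^j (\<lambda>I
  - F)^(-1) D, and multiplying by \<lambda> splits off its leading coefficient C F^j D.\<close>

lemma var_mult_reduction_tail:
  "ratfun_var * reduction_tail S A (Suc j) i v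
    = ratfun_const (avoiding_walks S A (Suc j) i v) + reduction_tail S A (Suc (Suc j)) i v"
proof -
  \<comment> \<open>The premise concerns rows outside \<open>S\<close> only, while the conclusion
    holds for every row; so the restricted case of index 0 can start the induction.\<close>
  have step: "ratfun_var * reduction_tail S A (Suc j) i v
      = ratfun_const (avoiding_walks S A (Suc j) i v) + reduction_tail S A (Suc (Suc j)) i v"
    if "\<And>k. k \<in> -S \<Longrightarrow> ratfun_var * reduction_tail S A j k v
      = ratfun_const (avoiding_walks S A j k v) + reduction_tail S A (Suc j) k v" for i j
  proof -
    have "ratfun_var * reduction_tail S A (Suc j) i v
        = (\<Sum>k\<in>-S. ratfun_const (A $ i $ k) * (ratfun_var * reduction_tail S A j k v))"
      by (simp add: sum_distrib_left mult.left_commute)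
    also have "\<dots> = (\<Sum>k\<in>-S. ratfun_const (A $ i $ k * avoiding_walks S A j k v)
        + ratfun_const (A $ i $ k) * reduction_tail S A (Suc j) k v)"
      by (intro sum.cong refl, subst that) (auto simp: distrib_left ratfun_const_mult)
    also have "\<dots> = ratfun_const (avoiding_walks S A (Suc j) i v)
        + reduction_tail S A (Suc (Suc j)) i v"
      by (simp add: sum.distrib ratfun_const_sum)
    finally show ?thesis .
  qed
  show ?thesis
  proof (induction j arbitrary: i)
    case 0
    show ?case
      by (rule step) (simp add: var_mult_reduction_tail_0 del: reduction_tail.simps(1))
  next
    case (Suc j)
    show ?case by (rule step) (rule Suc)
  qed
qed

text \<open>On rows outside \<open>S\<close>, the tail of index 0 solves the resolvent equation;
  later tails are constant combinations of such entries.\<close>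

lemma strictly_proper_reduction_tail:
  "strictly_proper (reduction_tail S A (Suc j) i v)"
proof (induction j arbitrary: i)
  case 0
  have "strictly_proper (reduction_tail S A 0 k v)" if "k \<in> -S" for k
    by (rule strictly_proper_resolvent[OF _ var_mult_reduction_tail_0 that]) simp_all
  then show ?case
    by (subst reduction_tail.simps(2)) (intro strictly_proper_sum strictly_proper_const_mult)
next
  case (Suc j)
  then show ?case
    by (subst reduction_tail.simps(2)) (intro strictly_proper_sum strictly_proper_const_mult)
qed

text \<open>Coefficients are compared one by one: equality of the tails is carried along, as
  multiplying it by \<lambda> exposes the next coefficient.\<close>

lemma isospectral_reduction_determines_avoiding_walks:
  assumes "isospectral_reduction S A u v = isospectral_reduction T B u' v'"
  shows "avoiding_walks S A j u v = avoiding_walks T B j u' v'"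
proof -
  have "avoiding_walks S A j u v = avoiding_walks T B j u' v'
      \<and> reduction_tail S A (Suc j) u v = reduction_tail T B (Suc j) u' v'"
  proof (induction j)
    case 0
    show ?case
      using assms unfolding isospectral_reduction_eq_tail
      by (rule const_plus_strictly_proper_eqD) (rule strictly_proper_reduction_tail)+
  next
    case (Suc j)
    then have "ratfun_var * reduction_tail S A (Suc j) u v
        = ratfun_var * reduction_tail T B (Suc j) u' v'"
      by metis
    then show ?case
      unfolding var_mult_reduction_tail
      by (rule const_plus_strictly_proper_eqD) (rule strictly_proper_reduction_tail)+
  qed
  then show ?thesis ..
qed

section \<open>First-return decomposition of walks\<close>

text \<open>A walk ending in \<open>S\<close> is cut at its first vertex in \<open>S\<close> after
  the start, reached at step \<open>j + 1\<close>. The start \<open>i\<close> is arbitrary because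
  the induction passes through vertices outside \<open>S\<close>.\<close>

lemma matrix_pow_first_return:
  fixes A :: "complex^'n::finite^'n"
  assumes "w \<in> S"
  shows "matrix_pow A (Suc k) $ i $ w
    = (\<Sum>j\<le>k. \<Sum>v\<in>S. avoiding_walks S A j i v * matrix_pow A (k - j) $ v $ w)"
proof (induction k arbitrary: i)
  case 0
  have "(\<Sum>v\<in>S. A $ i $ v * (if v = w then 1 else 0)) = A $ i $ w"
    using assms by (simp add: mult_delta_right)
  then show ?case
    by (simp add: mat_def matrix_matrix_mult_def mult_delta_right)
next
  case (Suc k)
  have "matrix_pow A (Suc (Suc k)) $ i $ w
      = (\<Sum>l\<in>UNIV. A $ i $ l * matrix_pow A (Suc k) $ l $ w)"
    by (simp add: matrix_matrix_mult_def)
  \<comment> \<open>A first step into \<open>S\<close> gives the summand for \<open>j = 0\<close>;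
    one leaving \<open>S\<close> prolongs an avoiding walk and shifts \<open>j\<close> by
    one.\<close>
  also have "\<dots> = (\<Sum>l\<in>S. A $ i $ l * matrix_pow A (Suc k) $ l $ w)
      + (\<Sum>l\<in>-S. A $ i $ l * matrix_pow A (Suc k) $ l $ w)"
    by (subst sum.union_disjoint[symmetric]) auto
  also have "(\<Sum>l\<in>-S. A $ i $ l * matrix_pow A (Suc k) $ l $ w)
      = (\<Sum>l\<in>-S. \<Sum>j\<le>k. \<Sum>v\<in>S. A $ i $ l * avoiding_walks S A j l v * matrix_pow A (k - j) $ v $ w)"
    unfolding Suc by (simp add: sum_distrib_left mult.assoc)
  also have "\<dots> = (\<Sum>j\<le>k. \<Sum>v\<in>S. \<Sum>l\<in>-S. A $ i $ l * avoiding_walks S A j l v * matrix_pow A (k - j) $ v $ w)"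
    by (subst sum.swap) (intro sum.cong refl sum.swap)
  also have "\<dots> = (\<Sum>j\<le>k. \<Sum>v\<in>S. avoiding_walks S A (Suc j) i v * matrix_pow A (Suc k - Suc j) $ v $ w)"
    by (simp add: sum_distrib_right)
  finally show ?case
    by (subst sum.atMost_Suc_shift) simp
qed

text \<open>The first-return formula is a recursion over all smaller powers that involves only their
  entries on \<open>S\<close>, whence the strong induction.\<close>

lemma isospectral_reduction_determines_matrix_pow:
  fixes A :: "complex^'g::finite^'g" and B :: "complex^'h::finite^'h"
  assumes bij: "bij_betw \<phi> S T"
    and red: "\<forall>u\<in>S. \<forall>v\<in>S.
           isospectral_reduction S A u v = isospectral_reduction T B (\<phi> u) (\<phi> v)"
    and "u \<in> S" "w \<in> S"
  shows "matrix_pow A k $ u $ w = matrix_pow B k $ \<phi> u $ \<phi> w"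
  using assms(3)
proof (induction k arbitrary: u rule: less_induct)
  case (less k)
  show ?case
  proof (cases k)
    case 0
    \<comment> \<open>Identity matrices correspond because \<open>\<phi>\<close> is injective on
      \<open>S\<close>.\<close>
    then show ?thesis
      using less.prems assms(4) bij by (auto simp: mat_def bij_betw_def inj_on_eq_iff)
  next
    case (Suc n)
    have "matrix_pow A (Suc n) $ u $ w
      = (\<Sum>j\<le>n. \<Sum>v\<in>S. avoiding_walks T B j (\<phi> u) (\<phi> v) * matrix_pow B (n - j) $ \<phi> v $ \<phi> w)"
      unfolding matrix_pow_first_return[OF assms(4)]
      using less.prems red Suc
      by (intro sum.cong refl arg_cong2[of _ _ _ _ "(*)"] less.IH
            isospectral_reduction_determines_avoiding_walks) auto
    also have "\<dots> = (\<Sum>j\<le>n. \<Sum>v\<in>T. avoiding_walks T B j (\<phi> u) v * matrix_pow B (n - j) $ v $ \<phi> w)"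
      by (intro sum.cong refl sum.reindex_bij_betw bij)
    also have "\<dots> = matrix_pow B (Suc n) $ \<phi> u $ \<phi> w"
      using bij assms(4) by (intro matrix_pow_first_return[symmetric]) (auto simp: bij_betw_def)
    finally show ?thesis
      by (simp add: Suc)
  qed
qed

section \<open>The transition matrix\<close>

lemma matrix_pow_add: "matrix_pow A (j + k) = matrix_pow A j ** matrix_pow A k"
  by (induction j) (simp_all add: matrix_mul_assoc)

lemma matrix_pow_scale:
  "matrix_pow (\<chi> i j. c * A $ i $ j) k $ i $ j = c ^ k * matrix_pow A k $ i $ j"
  for A :: "complex^'n^'n"
  by (induction k arbitrary: i)
    (simp_all add: matrix_matrix_mult_def sum_distrib_left mult_ac)

lemma hermitian_matrix_pow:
  assumes "hermitian A"
  shows "hermitian (matrix_pow A k)"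
proof (induction k)
  case 0
  show ?case by (auto simp: hermitian_def mat_def)
next
  case (Suc k)
  \<comment> \<open>Conjugate transposition reverses the factors, so the power is needed with
    \<open>A\<close> on the right.\<close>
  have comm: "matrix_pow A (Suc k) = matrix_pow A k ** A"
    using matrix_pow_add[of A k "Suc 0"] by simp
  have "matrix_pow A (Suc k) $ i $ j = cnj (matrix_pow A (Suc k) $ j $ i)" for i j
  proof -
    have "cnj (matrix_pow A (Suc k) $ j $ i)
        = (\<Sum>l\<in>UNIV. cnj (A $ j $ l) * cnj (matrix_pow A k $ l $ i))"
      by (simp add: matrix_matrix_mult_def)
    also have "\<dots> = (\<Sum>l\<in>UNIV. matrix_pow A k $ i $ l * A $ l $ j)"
    proof (intro sum.cong refl)
      fix l
      have "cnj (A $ j $ l) = A $ l $ j" "cnj (matrix_pow A k $ l $ i) = matrix_pow A k $ i $ l"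
        using assms Suc unfolding hermitian_def by metis+
      then show "cnj (A $ j $ l) * cnj (matrix_pow A k $ l $ i) = matrix_pow A k $ i $ l * A $ l $ j"
        by simp
    qed
    finally show ?thesis
      unfolding comm by (simp add: matrix_matrix_mult_def)
  qed
  then show ?case
    unfolding hermitian_def by blast
qed

lemma norm_matrix_pow_entry_le:
  fixes A :: "complex^'n::finite^'n"
  shows "norm (matrix_pow A k $ i $ j) \<le> (\<Sum>a\<in>UNIV. \<Sum>b\<in>UNIV. norm (A $ a $ b)) ^ k"
proof (induction k arbitrary: i)
  case 0
  show ?case by (simp add: mat_def)
next
  case (Suc k)
  let ?c = "\<Sum>a\<in>UNIV. \<Sum>b\<in>UNIV. norm (A $ a $ b)"
  have "norm (matrix_pow A (Suc k) $ i $ j)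
      \<le> (\<Sum>l\<in>UNIV. norm (A $ i $ l) * norm (matrix_pow A k $ l $ j))"
    unfolding matrix_pow.simps matrix_matrix_mult_def
    by (simp add: sum_norm_le norm_mult)
  also have "\<dots> \<le> (\<Sum>l\<in>UNIV. norm (A $ i $ l) * ?c ^ k)"
    by (intro sum_mono mult_left_mono Suc) simp
  also have "\<dots> = (\<Sum>l\<in>UNIV. norm (A $ i $ l)) * ?c ^ k"
    by (simp add: sum_distrib_right)
  also have "\<dots> \<le> ?c * ?c ^ k"
    by (intro mult_right_mono member_le_sum[of i UNIV "\<lambda>a. \<Sum>b\<in>UNIV. norm (A $ a $ b)"] zero_le_power sum_nonneg) (auto intro: sum_nonneg)
  finally show ?case by simp
qed

text \<open>The scalar \<open>z\<close> is kept apart from \<open>A\<close>, so that reversing time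
  only changes its sign.\<close>

definition exp_term :: "complex^'n^'n \<Rightarrow> complex \<Rightarrow> 'n \<Rightarrow> 'n \<Rightarrow> nat \<Rightarrow> complex" where
  "exp_term A z i j k = z ^ k * matrix_pow A k $ i $ j / fact k"

lemma summable_norm_exp_term:
  fixes A :: "complex^'n::finite^'n"
  shows "summable (\<lambda>k. norm (exp_term A z i j k))"
proof (rule summable_comparison_test')
  let ?c = "\<Sum>a\<in>UNIV. \<Sum>b\<in>UNIV. norm (A $ a $ b)"
  show "summable (\<lambda>k. inverse (fact k) * (norm z * ?c) ^ k)"
    by (rule summable_exp)
  fix k :: nat assume "0 \<le> k"
  have "norm z ^ k * norm (matrix_pow A k $ i $ j) \<le> norm z ^ k * ?c ^ k"
    by (intro mult_left_mono norm_matrix_pow_entry_le) simp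
  then show "norm (norm (exp_term A z i j k)) \<le> inverse (fact k) * (norm z * ?c) ^ k"
    by (simp add: exp_term_def norm_mult norm_divide norm_power power_mult_distrib divide_simps)
qed

lemma transition_matrix_sums:
  fixes A :: "complex^'n::finite^'n"
  shows "exp_term A (- (\<i> * of_real t)) i j sums (transition_matrix A t $ i $ j)"
proof -
  define z where "z = - (\<i> * of_real t)"
  define E where "E = (\<chi> i j. suminf (exp_term A z i j))"
  have E: "exp_term A z i j sums (E $ i $ j)" for i j
    unfolding E_def by (simp add: summable_sums summable_norm_cancel[OF summable_norm_exp_term])
  have "(\<lambda>k. (1 / fact k) *\<^sub>R matrix_pow (\<chi> i j. z * A $ i $ j) k) sums E"
    unfolding sums_def
  proof (intro vec_tendstoI)
    fix i j
    have "(\<lambda>n. (\<Sum>k<n. (1 / fact k) *\<^sub>R matrix_pow (\<chi> i j. z * A $ i $ j) k) $ i $ j)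
        = (\<lambda>n. \<Sum>k<n. exp_term A z i j k)"
      unfolding sum_component vector_scaleR_component
      by (simp add: matrix_pow_scale exp_term_def scaleR_conv_of_real)
    then show "(\<lambda>n. (\<Sum>k<n. (1 / fact k) *\<^sub>R matrix_pow (\<chi> i j. z * A $ i $ j) k) $ i $ j)
        \<longlonglongrightarrow> E $ i $ j"
      using E[of i j] by (simp add: sums_def)
  qed
  then have "transition_matrix A t = E"
    unfolding transition_matrix_def matrix_exp_def z_def by (simp add: sums_iff)
  then show ?thesis
    using E by (simp add: z_def)
qed

section \<open>Unitarity\<close>

text \<open>By absolute convergence the entries multiply as Cauchy products. The binomial theorem
  makes the term of order \<open>k\<close> a multiple of \<open>(- z + z) ^ k\<close>, so only order
  0 survives.\<close>

lemma transition_matrix_mult_minus: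
  fixes A :: "complex^'n::finite^'n"
  shows "transition_matrix A (- t) ** transition_matrix A t = mat 1"
proof -
  define z where "z = - (\<i> * of_real t)"
  have "(transition_matrix A (- t) ** transition_matrix A t) $ u $ v = mat 1 $ u $ v" for u v
  proof -
    have "(\<lambda>k. \<Sum>l\<le>k. exp_term A (- z) u w l * exp_term A z w v (k - l)) sums
        (transition_matrix A (- t) $ u $ w * transition_matrix A t $ w $ v)" for w
      using Cauchy_product_sums[OF summable_norm_exp_term summable_norm_exp_term,
          of A "- z" u w A z w v]
        transition_matrix_sums[of A "- t" u w] transition_matrix_sums[of A t w v]
      by (simp add: z_def sums_iff)
    then have sums: "(\<lambda>k. \<Sum>w\<in>UNIV. \<Sum>l\<le>k. exp_term A (- z) u w l * exp_term A z w v (k - l)) sums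
        ((transition_matrix A (- t) ** transition_matrix A t) $ u $ v)"
      unfolding matrix_matrix_mult_def by (auto intro: sums_sum)
    have "(\<Sum>w\<in>UNIV. \<Sum>l\<le>k. exp_term A (- z) u w l * exp_term A z w v (k - l))
        = (if k = 0 then mat 1 $ u $ v else 0)" for k
    proof -
      have "(\<Sum>w\<in>UNIV. \<Sum>l\<le>k. exp_term A (- z) u w l * exp_term A z w v (k - l))
          = (\<Sum>l\<le>k. \<Sum>w\<in>UNIV. exp_term A (- z) u w l * exp_term A z w v (k - l))"
        by (rule sum.swap)
      also have "\<dots> = (\<Sum>l\<le>k. of_nat (k choose l) * (- z) ^ l * z ^ (k - l)
          * matrix_pow A k $ u $ v / fact k)"
      proof (intro sum.cong refl)
        fix l assume l: "l \<in> {..k}"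
        have "(\<Sum>w\<in>UNIV. exp_term A (- z) u w l * exp_term A z w v (k - l))
            = (- z) ^ l * z ^ (k - l) / (fact l * fact (k - l))
              * (\<Sum>w\<in>UNIV. matrix_pow A l $ u $ w * matrix_pow A (k - l) $ w $ v)"
          by (simp add: exp_term_def sum_distrib_left mult_ac)
        also have "(\<Sum>w\<in>UNIV. matrix_pow A l $ u $ w * matrix_pow A (k - l) $ w $ v)
            = matrix_pow A k $ u $ v"
          using l matrix_pow_add[of A l "k - l"] by (simp add: matrix_matrix_mult_def)
        finally show "(\<Sum>w\<in>UNIV. exp_term A (- z) u w l * exp_term A z w v (k - l))
            = of_nat (k choose l) * (- z) ^ l * z ^ (k - l) * matrix_pow A k $ u $ v / fact k"
          using l by (simp add: binomial_fact field_simps)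
      qed
      also have "\<dots> = (- z + z) ^ k * matrix_pow A k $ u $ v / fact k"
        by (simp only: binomial_ring sum_distrib_right sum_divide_distrib)
      finally show ?thesis
        by (cases k) simp_all
    qed
    then have "(\<lambda>k. if k = 0 then mat 1 $ u $ v else 0) sums
        ((transition_matrix A (- t) ** transition_matrix A t) $ u $ v)"
      using sums by simp
    moreover have "(\<lambda>k. if k = 0 then mat 1 $ u $ v else 0 :: complex) sums (mat 1 $ u $ v)"
      using sums_single[of 0 "\<lambda>_. mat 1 $ u $ v :: complex"] by simp
    ultimately show ?thesis
      by (rule sums_unique2)
  qed
  then show ?thesis
    by (simp add: vec_eq_iff)
qed

lemma cnj_transition_matrix:
  fixes A :: "complex^'n::finite^'n"
  assumes "hermitian A"
  shows "cnj (transition_matrix A t $ i $ j) = transition_matrix A (- t) $ j $ i"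
proof -
  have "cnj (matrix_pow A k $ i $ j) = matrix_pow A k $ j $ i" for k
    using hermitian_matrix_pow[OF assms, of k] unfolding hermitian_def by metis
  then have "(\<lambda>k. cnj (exp_term A (- (\<i> * of_real t)) i j k))
      = exp_term A (- (\<i> * of_real (- t))) j i"
    by (simp add: exp_term_def fun_eq_iff)
  then have "exp_term A (- (\<i> * of_real (- t))) j i sums cnj (transition_matrix A t $ i $ j)"
    using transition_matrix_sums[of A t i j] by (metis sums_cnj)
  then show ?thesis
    using transition_matrix_sums[of A "- t" j i] by (rule sums_unique2)
qed

text \<open>For Hermitian \<open>A\<close> the conjugate transpose of U(t) is U(-t), so this is a
  diagonal entry of U(-t) U(t) = I.\<close>

lemma transition_matrix_column_norm:
  fixes A :: "complex^'n::finite^'n"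
  assumes "hermitian A"
  shows "(\<Sum>w\<in>UNIV. (norm (transition_matrix A t $ w $ u))\<^sup>2) = 1"
proof -
  have "complex_of_real (\<Sum>w\<in>UNIV. (norm (transition_matrix A t $ w $ u))\<^sup>2)
      = (\<Sum>w\<in>UNIV. transition_matrix A (- t) $ u $ w * transition_matrix A t $ w $ u)"
    by (simp only: of_real_sum complex_norm_square cnj_transition_matrix[OF assms] mult.commute)
  also have "\<dots> = (transition_matrix A (- t) ** transition_matrix A t) $ u $ u"
    by (simp add: matrix_matrix_mult_def)
  also have "\<dots> = 1"
    by (simp add: transition_matrix_mult_minus mat_def)
  finally show ?thesis
    by (simp only: of_real_eq_1_iff)
qed

section \<open>Perfect state transfer from a single entry\<close>

lemma pst_at_iff:
  fixes A :: "complex^'n::finite^'n"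
  assumes "hermitian A"
  shows "pst_at A t u v \<longleftrightarrow> norm (transition_matrix A t $ v $ u) = 1"
proof -
  let ?U = "transition_matrix A t"
  have col: "?U *v axis u 1 = (\<chi> w. ?U $ w $ u)"
    by (simp add: matrix_vector_mult_def axis_def mult_delta_right)
  show ?thesis
  proof
    assume "pst_at A t u v"
    then obtain \<gamma> where "norm \<gamma> = 1" and "(\<chi> w. ?U $ w $ u) = \<gamma> *s axis v 1"
      unfolding pst_at_def col by blast
    then show "norm (?U $ v $ u) = 1"
      by (auto simp: vec_eq_iff axis_def)
  next
    assume 1: "norm (?U $ v $ u) = 1"
    have "(\<Sum>w\<in>UNIV. (norm (?U $ w $ u))\<^sup>2)
        = (norm (?U $ v $ u))\<^sup>2 + (\<Sum>w\<in>UNIV - {v}. (norm (?U $ w $ u))\<^sup>2)"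
      by (simp add: sum.remove)
    \<comment> \<open>The entry at \<open>v\<close> exhausts the unit norm of the column and serves
      as the phase \<open>\<gamma>\<close>.\<close>
    then have "(\<Sum>w\<in>UNIV - {v}. (norm (?U $ w $ u))\<^sup>2) = 0"
      using 1 transition_matrix_column_norm[OF assms, of t u] by simp
    then have "?U $ w $ u = 0" if "w \<noteq> v" for w
      using that by (simp add: sum_nonneg_eq_0_iff)
    then have "?U *v axis u 1 = (?U $ v $ u) *s axis v 1"
      unfolding col by (simp add: vec_eq_iff axis_def)
    with 1 show "pst_at A t u v"
      unfolding pst_at_def by blast
  qed
qed

theorem corollary4p2:
  fixes A\<^sub>G :: "complex^'g^'g" and A\<^sub>H :: "complex^'h^'h"
    and S :: "'g::finite set" and T :: "'h::finite set" and \<phi> :: "'g \<Rightarrow> 'h"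
  assumes "hermitian A\<^sub>G" and "hermitian A\<^sub>H"
    and "bij_betw \<phi> S T"
    and "\<forall>u\<in>S. \<forall>v\<in>S.
           isospectral_reduction S A\<^sub>G u v = isospectral_reduction T A\<^sub>H (\<phi> u) (\<phi> v)"
  shows "\<forall>u\<in>S. \<forall>v\<in>S.
           perfect_state_transfer A\<^sub>G u v \<longleftrightarrow> perfect_state_transfer A\<^sub>H (\<phi> u) (\<phi> v)"
proof (intro ballI)
  fix u v assume "u \<in> S" "v \<in> S"
  \<comment> \<open>Transfer from \<open>u\<close> to \<open>v\<close> is read off row
    \<open>v\<close>, column \<open>u\<close>. The entries agree at every time, so the same time
    serves both graphs.\<close>
  then have "exp_term A\<^sub>G z v u = exp_term A\<^sub>H z (\<phi> v) (\<phi> u)" for z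
    using isospectral_reduction_determines_matrix_pow[OF assms(3,4)]
    by (simp add: exp_term_def fun_eq_iff)
  then have "transition_matrix A\<^sub>G t $ v $ u = transition_matrix A\<^sub>H t $ \<phi> v $ \<phi> u" for t
    using transition_matrix_sums[of A\<^sub>G t v u] transition_matrix_sums[of A\<^sub>H t "\<phi> v" "\<phi> u"]
    by (metis sums_unique2)
  then show "perfect_state_transfer A\<^sub>G u v \<longleftrightarrow> perfect_state_transfer A\<^sub>H (\<phi> u) (\<phi> v)"
    by (simp add: perfect_state_transfer_def pst_at_iff assms(1,2))
qed

end
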